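(* Let $L$ be a finite dimensional Lie superalgebra and let $\mathfrak{g}\subseteq L$ be a subalgebra. Then for any $x\in\mathfrak{g}$, $$\operatorname{sol}_{L}(x)\cap\mathfrak{g}=\operatorname{sol}_{\mathfrak{g}}(x).$$
   Context: All Lie superalgebras $L=L_{\bar 0}\oplus L_{\bar 1}$ are over a fixed field $\mathbb{F}$ with $\operatorname{char}\mathbb{F}\neq 2$ (if $\operatorname{char}\mathbb{F}=3$, the axioms also include $[x,[x,x]]=0$ for all $x\in L_{\bar 1}$). "Subalgebra" means subsuperalgebra ($\mathbb{Z}_2$-graded subspace closed under the bracket), and $\langle x,y\rangle$ denotes the subalgebra (subsuperalgebra) generated by the (not necessarily homogeneous) elements $x,y$. A Lie superalgebra is solvable if its derived series $L^{(0)}=L$, $L^{(k+1)}=[L^{(k)},L^{(k)}]$ reaches $0$. For a finite dimensional Lie superalgebra $K$ and $x\in K$, $\operatorname{sol}_K(x)=\{y\in K\mid \langle x,y\rangle \text{ is a solvable subalgebra of } K\}$. *)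

theory Defs
  imports Complex_Main "HOL-Library.Z2"
begin

text \<open>
  A superalgebra is given by its homogeneous components, which are subspaces of an ambient
  vector space on the type \<open>'a\<close>; the parity is an element of the field \<^typ>\<open>bit\<close>.
  The underlying space of the superalgebra is \<open>carrier\<close> below, not all of \<open>'a\<close>, and the
  bracket is only constrained there.  This way a subalgebra is again a value of the same
  record type.
\<close>

record ('f, 'a) superalgebra =
  scalar :: "'f \<Rightarrow> 'a \<Rightarrow> 'a"
  component :: "bit \<Rightarrow> 'a set"
  bracket :: "'a \<Rightarrow> 'a \<Rightarrow> 'a"

definition carrier :: "('f, 'a::ab_group_add) superalgebra \<Rightarrow> 'a set" where
  "carrier L = {a + b | a b. a \<in> component L 0 \<and> b \<in> component L 1}"

text \<open>The sign \<open>(-1)\<^sup>i\<^sup>j\<close>.\<close>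

definition koszul_sign :: "bit \<Rightarrow> bit \<Rightarrow> 'f::field" where
  "koszul_sign i j = (if i * j = 1 then - 1 else 1)"

text \<open>
  These are the axioms for fields of characteristic other than 2; characteristic 2 would
  need further ones.
\<close>

locale lie_superalgebra =
  vector_space "scalar L" for L :: "('f::field, 'a::ab_group_add) superalgebra" +
  assumes subspace_component: "subspace (component L i)"
    and component_Int: "component L 0 \<inter> component L 1 = {0}"
    and bracket_component:
      "x \<in> component L i \<Longrightarrow> y \<in> component L j \<Longrightarrow> bracket L x y \<in> component L (i + j)"
    and bracket_add_left:
      "x \<in> carrier L \<Longrightarrow> y \<in> carrier L \<Longrightarrow> z \<in> carrier L \<Longrightarrow>
        bracket L (x + y) z = bracket L x z + bracket L y z"
    and bracket_add_right:
      "x \<in> carrier L \<Longrightarrow> y \<in> carrier L \<Longrightarrow> z \<in> carrier L \<Longrightarrow>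
        bracket L x (y + z) = bracket L x y + bracket L x z"
    and bracket_scalar_left:
      "x \<in> carrier L \<Longrightarrow> y \<in> carrier L \<Longrightarrow>
        bracket L (scalar L c x) y = scalar L c (bracket L x y)"
    and bracket_scalar_right:
      "x \<in> carrier L \<Longrightarrow> y \<in> carrier L \<Longrightarrow>
        bracket L x (scalar L c y) = scalar L c (bracket L x y)"
    and super_skew_symmetry:
      "x \<in> component L i \<Longrightarrow> y \<in> component L j \<Longrightarrow>
        bracket L x y = - scalar L (koszul_sign i j) (bracket L y x)"
    and super_Jacobi:
      "x \<in> component L i \<Longrightarrow> y \<in> component L j \<Longrightarrow> z \<in> component L k \<Longrightarrow>
        bracket L x (bracket L y z) =
          bracket L (bracket L x y) z
            + scalar L (koszul_sign i j) (bracket L y (bracket L x z))"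
    and char_3:
      "CHAR('f) = 3 \<Longrightarrow> x \<in> component L 1 \<Longrightarrow> bracket L x (bracket L x x) = 0"

definition finite_dimensional :: "('f::field, 'a::ab_group_add) superalgebra \<Rightarrow> bool" where
  "finite_dimensional L \<longleftrightarrow> (\<exists>B. finite B \<and> carrier L = module.span (scalar L) B)"

text \<open>
  The third conjunct is the requirement that the subspace is graded: it contains both
  homogeneous components of each of its elements.
\<close>

definition subalgebra :: "('f::field, 'a::ab_group_add) superalgebra \<Rightarrow> 'a set \<Rightarrow> bool" where
  "subalgebra L S \<longleftrightarrow>
    S \<subseteq> carrier L \<and>
    module.subspace (scalar L) S \<and>
    S = {a + b | a b. a \<in> S \<inter> component L 0 \<and> b \<in> S \<inter> component L 1} \<and>
    (\<forall>x\<in>S. \<forall>y\<in>S. bracket L x y \<in> S)"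

definition restrict_to ::
    "('f, 'a::ab_group_add) superalgebra \<Rightarrow> 'a set \<Rightarrow> ('f, 'a) superalgebra" where
  "restrict_to L S = L\<lparr>component := \<lambda>i. component L i \<inter> S\<rparr>"

definition generated :: "('f::field, 'a::ab_group_add) superalgebra \<Rightarrow> 'a set \<Rightarrow> 'a set" where
  "generated L X = subalgebra L hull X"

primrec derived_series ::
    "('f::field, 'a::ab_group_add) superalgebra \<Rightarrow> nat \<Rightarrow> 'a set" where
  "derived_series L 0 = carrier L"
| "derived_series L (Suc k) =
    module.span (scalar L)
      {bracket L x y | x y. x \<in> derived_series L k \<and> y \<in> derived_series L k}"

definition solvable :: "('f::field, 'a::ab_group_add) superalgebra \<Rightarrow> bool" where
  "solvable L \<longleftrightarrow> (\<exists>k. derived_series L k = {0})"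

definition sol :: "('f::field, 'a::ab_group_add) superalgebra \<Rightarrow> 'a \<Rightarrow> 'a set" where
  "sol L x = {y \<in> carrier L. solvable (restrict_to L (generated L {x, y}))}"

context lie_superalgebra
begin

lemma component_subset_carrier: "component L i \<subseteq> carrier L"
proof -
  have "0 \<in> component L j" for j
    using subspace_0 subspace_component by blast
  then show ?thesis
    unfolding carrier_def by (cases i) force+
qed

lemma carrier_restrict_to:
  assumes "subalgebra L S"
  shows "carrier (restrict_to L S) = S"
  using assms unfolding subalgebra_def carrier_def restrict_to_def by (simp add: Int_commute)

lemma lie_superalgebra_restrict_to:
  assumes S: "subalgebra L S"
  shows "lie_superalgebra (restrict_to L S)"
proof -
  have *: "S \<subseteq> carrier L" "subspace S" "\<And>x y. x \<in> S \<Longrightarrow> y \<in> S \<Longrightarrow> bracket L x y \<in> S"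
    using S by (auto simp: subalgebra_def)
  have sel: "scalar (restrict_to L S) = scalar L" "bracket (restrict_to L S) = bracket L"
      "component (restrict_to L S) i = component L i \<inter> S" for i
    by (auto simp: restrict_to_def)
  show ?thesis
  proof (intro lie_superalgebra.intro lie_superalgebra_axioms.intro, unfold sel carrier_restrict_to[OF S])
    show "vector_space (scalar L)" by unfold_locales
    show "subspace (component L i \<inter> S)" for i
      using subspace_inter subspace_component * by blast
    show "bracket L x y \<in> component L (i + j) \<inter> S"
      if "x \<in> component L i \<inter> S" "y \<in> component L j \<inter> S" for x y i j
      using that bracket_component * by blast
    show "component L 0 \<inter> S \<inter> (component L 1 \<inter> S) = {0}"
      using component_Int subspace_0 * by blast
  qed (use * in \<open>auto intro: bracket_component bracket_add_left bracket_add_right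
      bracket_scalar_left bracket_scalar_right super_skew_symmetry super_Jacobi char_3\<close>)
qed

lemma finite_dimensional_restrict_to:
  assumes "finite_dimensional L" and S: "subalgebra L S"
  shows "finite_dimensional (restrict_to L S)"
proof -
  obtain B where B: "finite B" "carrier L = span B"
    using assms by (auto simp: finite_dimensional_def)
  obtain C where C: "C \<subseteq> S" "independent C" "S \<subseteq> span C"
    using maximal_independent_subset[of S] by blast
  have "C \<subseteq> span B"
    using C S B by (auto simp: subalgebra_def)
  then have "finite C"
    using independent_span_bound[OF B(1) C(2)] by blast
  moreover have "S = span C"
    using C S span_minimal[of C S] by (auto simp: subalgebra_def)
  ultimately show ?thesis
    using carrier_restrict_to[OF S] by (auto simp: finite_dimensional_def restrict_to_def)
qed

lemma subalgebra_carrier: "subalgebra L (carrier L)"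
proof -
  have "subspace (carrier L)"
    unfolding carrier_def by (rule subspace_sums) (rule subspace_component)+
  moreover have "bracket L x y \<in> carrier L" if xy: "x \<in> carrier L" "y \<in> carrier L" for x y
  proof -
    obtain a b c d where ab: "x = a + b" "a \<in> component L 0" "b \<in> component L 1"
      and cd: "y = c + d" "c \<in> component L 0" "d \<in> component L 1"
      using xy unfolding carrier_def by blast
    have c: "u \<in> component L i \<Longrightarrow> u \<in> carrier L" for u i
      using component_subset_carrier by blast
    have "bracket L x y = bracket L a c + bracket L a d + (bracket L b c + bracket L b d)"
      using ab cd c subspace_add[OF \<open>subspace (carrier L)\<close>]
      by (simp add: bracket_add_left bracket_add_right)
    moreover have "bracket L u v \<in> carrier L"
      if "u \<in> component L i" "v \<in> component L j" for u v i j
      using bracket_component[OF that] c by blast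
    ultimately show ?thesis
      using ab cd subspace_add[OF \<open>subspace (carrier L)\<close>] by metis
  qed
  moreover have "carrier L \<inter> component L i = component L i" for i
    using component_subset_carrier by blast
  ultimately show ?thesis
    unfolding subalgebra_def by (auto simp: carrier_def)
qed

lemma component_unique:
  assumes "a \<in> component L 0" "b \<in> component L 1" "c \<in> component L 0" "d \<in> component L 1"
    and "a + b = c + d"
  shows "a = c" "b = d"
proof -
  have "a - c = d - b"
    using assms(5) by (simp add: algebra_simps)
  moreover have "a - c \<in> component L 0" "d - b \<in> component L 1"
    using assms subspace_component subspace_diff by blast+
  ultimately have "a - c = 0"
    using component_Int by (metis Int_iff singletonD)
  then show "a = c" "b = d"
    using assms(5) by auto
qed

lemma subalgebra_generated:
  assumes "X \<subseteq> carrier L"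
  shows "subalgebra L (generated L X)"
proof -
  let ?G = "generated L X"
  have G: "u \<in> ?G \<longleftrightarrow> (\<forall>S. subalgebra L S \<and> X \<subseteq> S \<longrightarrow> u \<in> S)" for u
    by (auto simp: generated_def hull_def)
  have sub: "?G \<subseteq> carrier L"
    using assms subalgebra_carrier G by blast
  have ssp: "subspace ?G"
    unfolding generated_def hull_def by (rule subspace_Inter) (auto simp: subalgebra_def)
  moreover have "bracket L x y \<in> ?G" if "x \<in> ?G" "y \<in> ?G" for x y
    using that unfolding G by (auto simp: subalgebra_def)
  moreover have "?G = {a + b | a b. a \<in> ?G \<inter> component L 0 \<and> b \<in> ?G \<inter> component L 1}"
  proof (intro equalityI subsetI)
    fix u assume u: "u \<in> ?G"
    then obtain a b where ab: "u = a + b" "a \<in> component L 0" "b \<in> component L 1"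
      using sub unfolding carrier_def by blast
    have "a \<in> S \<and> b \<in> S" if S: "subalgebra L S" "X \<subseteq> S" for S
    proof -
      have "u \<in> S"
        using u G S by blast
      then obtain c d where "u = c + d" "c \<in> S \<inter> component L 0" "d \<in> S \<inter> component L 1"
        using S unfolding subalgebra_def by blast
      then show ?thesis
        using component_unique[of a b c d] ab by auto
    qed
    then show "u \<in> {a + b | a b. a \<in> ?G \<inter> component L 0 \<and> b \<in> ?G \<inter> component L 1}"
      using ab G by blast
  qed (use ssp subspace_add in auto)
  ultimately show ?thesis
    using sub unfolding subalgebra_def by blast
qed

end

end

theory Submission
  imports Defs
begin

text \<open>
  The statement holds because neither the subalgebra generated by \<open>x\<close> and \<open>y\<close> nor its
  solvability depends on the algebra in which it is formed.  The subalgebras of \<open>\<gg>\<close> are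
  exactly the subalgebras of \<open>L\<close> that lie inside \<open>\<gg>\<close>.  Since \<open>\<gg>\<close> itself is one of the
  subalgebras of \<open>L\<close> containing a given subset of \<open>\<gg>\<close>, intersecting only those inside \<open>\<gg>\<close>
  produces the same generated subalgebra (lemma \<open>generated_restrict_to\<close>).  Restricting \<open>L\<close>
  to it in one step or by way of \<open>\<gg>\<close> gives the same superalgebra, so the two solvability
  conditions are literally the same.
\<close>

lemma restrict_to_restrict_to:
  assumes "T \<subseteq> S"
  shows "restrict_to (restrict_to L S) T = restrict_to L T"
proof -
  have "component L i \<inter> S \<inter> T = component L i \<inter> T" for i
    using assms by blast
  then show ?thesis
    by (simp add: restrict_to_def)
qed

context lie_superalgebra
begin

lemma subalgebra_restrict_to_iff:
  assumes S: "subalgebra L S"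
  shows "subalgebra (restrict_to L S) T \<longleftrightarrow> subalgebra L T \<and> T \<subseteq> S"
proof (cases "T \<subseteq> S")
  case True
  have sel: "scalar (restrict_to L S) = scalar L" "bracket (restrict_to L S) = bracket L"
    "component (restrict_to L S) i = component L i \<inter> S" for i
    by (auto simp: restrict_to_def)
  have "T \<inter> (component L i \<inter> S) = T \<inter> component L i" for i
    using True by blast
  moreover have "T \<subseteq> carrier L"
    using True S by (auto simp: subalgebra_def)
  ultimately show ?thesis
    using True by (simp add: subalgebra_def[of _ T] sel carrier_restrict_to[OF S])
next
  case False
  then show ?thesis
    by (simp add: subalgebra_def[of _ T] carrier_restrict_to[OF S])
qed

lemma generated_subset:
  assumes "subalgebra L S" "X \<subseteq> S"
  shows "generated L X \<subseteq> S"
  unfolding generated_def using assms(2,1) by (rule hull_minimal)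

text \<open>
  Passing to \<open>S\<close> removes from the intersection that defines the hull only subalgebras not
  contained in \<open>S\<close>.  This cannot enlarge the intersection, because the hull in \<open>L\<close> is itself
  a subalgebra inside \<open>S\<close>.
\<close>

lemma generated_restrict_to:
  assumes S: "subalgebra L S" and X: "X \<subseteq> S"
  shows "generated (restrict_to L S) X = generated L X"
proof
  have "X \<subseteq> carrier L"
    using S X by (auto simp: subalgebra_def)
  then have "subalgebra (restrict_to L S) (generated L X)"
    using subalgebra_generated generated_subset[OF S X] subalgebra_restrict_to_iff[OF S] by blast
  moreover have "X \<subseteq> generated L X"
    unfolding generated_def by (rule hull_subset)
  ultimately show "generated (restrict_to L S) X \<subseteq> generated L X"
    unfolding generated_def[of "restrict_to L S"] by (intro hull_minimal)
  show "generated L X \<subseteq> generated (restrict_to L S) X"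
    unfolding generated_def using subalgebra_restrict_to_iff[OF S] by (intro hull_antimono) blast
qed

lemma sol_restrict_to:
  assumes S: "subalgebra L S" and x: "x \<in> S"
  shows "sol (restrict_to L S) x = sol L x \<inter> S"
proof -
  have "S \<subseteq> carrier L"
    using S by (simp add: subalgebra_def)
  moreover have "restrict_to (restrict_to L S) (generated (restrict_to L S) {x, y}) =
      restrict_to L (generated L {x, y})" if "y \<in> S" for y
    using x that by (simp add: generated_restrict_to[OF S] restrict_to_restrict_to
        generated_subset[OF S])
  ultimately show ?thesis
    by (auto simp: sol_def carrier_restrict_to[OF S])
qed

end

theorem theorem4:
  fixes L :: "('f::field, 'a::ab_group_add) superalgebra"
    and \<gg> :: "'a set" and x :: 'a
  assumes "CHAR('f) \<noteq> 2"
    and "lie_superalgebra L"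
    and "finite_dimensional L"
    and "subalgebra L \<gg>"
    and "x \<in> \<gg>"
  shows "sol L x \<inter> \<gg> = sol (restrict_to L \<gg>) x"
  using lie_superalgebra.sol_restrict_to[OF assms(2,4,5)] by simp

end
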